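(* Let $T_0 > \frac{1}{1-\lambda}\max_{c\in\mathcal{C}}\|A_c\|_\infty$ and let $U_0 = X\times(-T_0,T_0)$. Then: (a) $F(\overline{U_0})\subset U_0$. (b) $U_0$ is globally attracting, that is, for every $M>0$ there is $n\in\mathbb{N}$, depending only on $M$, such that $F^n(X\times[-M,M])\subset U_0$. (c) If $\Lambda$ is a nonempty compact subset of $X\times\mathbb{R}$ with $F(\Lambda)=\Lambda$, then $\Lambda\subset U_0$.
   Context: $X=\mathbb{R}/\mathbb{Z}$ with its quotient metric, $T:X\to X$ is the doubling map $T(x)=2x$, $0<\lambda<1$ is fixed, $\mathcal{C}=\{0,\dots,m-1\}$ with $m\ge 2$, and $A_c:X\to\mathbb{R}$ ($c\in\mathcal{C}$) are Lipschitz functions. For $c\in\mathcal{C}$, $G_c:X\times\mathbb{R}\to X\times\mathbb{R}$ is $G_c(x,y)=(T(x),A_c(x)+\lambda y)$. The Hutchinson–Barnsley operator is $F(U)=\bigcup_{c\in\mathcal{C}}G_c(U)$ for $U\subseteq X\times\mathbb{R}$, and $F^n$ is its $n$-th iterate. *)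

theory Defs
  imports "HOL-Analysis.Analysis"
begin

quotient_type circle = real / "\<lambda>x y. x - y \<in> \<int>"
  morphisms rep_circle circle_of
proof (rule equivpI)
  show "reflp (\<lambda>x y::real. x - y \<in> \<int>)"
    by (simp add: reflp_def)
  show "symp (\<lambda>x y::real. x - y \<in> \<int>)"
    by (metis (no_types, lifting) Ints_minus minus_diff_eq sympI)
  show "transp (\<lambda>x y::real. x - y \<in> \<int>)"
  proof (rule transpI)
    fix x y z :: real
    assume "x - y \<in> \<int>" "y - z \<in> \<int>"
    then have "(x - y) + (y - z) \<in> \<int>" by (rule Ints_add)
    then show "x - z \<in> \<int>" by simp
  qed
qed

lemma INF_int_dist_eq:
  fixes z :: real
  shows "(INF k::int. \<bar>z + of_int k\<bar>) = \<bar>z - of_int (round z)\<bar>"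
proof (rule cInf_eq_minimum)
  show "\<bar>z - of_int (round z)\<bar> \<in> range (\<lambda>k::int. \<bar>z + of_int k\<bar>)"
    by (rule range_eqI[of _ _ "- round z"]) simp
  fix w assume "w \<in> range (\<lambda>k::int. \<bar>z + of_int k\<bar>)"
  then obtain k :: int where w: "w = \<bar>z + of_int k\<bar>" by auto
  show "\<bar>z - of_int (round z)\<bar> \<le> w"
    using round_diff_minimal[of z "- k"] w by simp
qed

instantiation circle :: metric_space
begin

(* The quotient metric: the distance between the cosets x + Z and y + Z,
   i.e. the infimum of the distances between their representatives. *)
lift_definition dist_circle :: "circle \<Rightarrow> circle \<Rightarrow> real"
  is "\<lambda>x y. INF k::int. \<bar>x - y + of_int k\<bar>"
proof -
  fix x x' y y' :: real
  assume "x - x' \<in> \<int>" "y - y' \<in> \<int>"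
  then have "(x - x') - (y - y') \<in> \<int>" by (rule Ints_diff)
  then obtain j where j: "(x - x') - (y - y') = of_int j" by (auto elim: Ints_cases)
  have "range (\<lambda>k::int. \<bar>x - y + of_int k\<bar>) = range (\<lambda>k::int. \<bar>x' - y' + of_int k\<bar>)"
  proof (rule set_eqI, rule iffI)
    fix w assume "w \<in> range (\<lambda>k::int. \<bar>x - y + of_int k\<bar>)"
    then obtain k :: int where "w = \<bar>x - y + of_int k\<bar>" by auto
    with j have "w = \<bar>x' - y' + of_int (k + j)\<bar>" by (simp add: algebra_simps)
    then show "w \<in> range (\<lambda>k::int. \<bar>x' - y' + of_int k\<bar>)" by blast
  next
    fix w assume "w \<in> range (\<lambda>k::int. \<bar>x' - y' + of_int k\<bar>)"
    then obtain k :: int where "w = \<bar>x' - y' + of_int k\<bar>" by auto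
    with j have "w = \<bar>x - y + of_int (k - j)\<bar>" by (simp add: algebra_simps)
    then show "w \<in> range (\<lambda>k::int. \<bar>x - y + of_int k\<bar>)" by blast
  qed
  then show "(INF k::int. \<bar>x - y + of_int k\<bar>) = (INF k::int. \<bar>x' - y' + of_int k\<bar>)"
    by simp
qed

definition uniformity_circle :: "(circle \<times> circle) filter"
  where "uniformity_circle = (INF e\<in>{0<..}. principal {(x, y). dist x y < e})"

definition open_circle :: "circle set \<Rightarrow> bool"
  where "open_circle U \<longleftrightarrow> (\<forall>x\<in>U. eventually (\<lambda>(x', y). x' = x \<longrightarrow> y \<in> U) uniformity)"

instance
proof
  show "uniformity = (INF e\<in>{0<..}. principal {(x::circle, y). dist x y < e})"
    by (rule uniformity_circle_def)
  show "open U \<longleftrightarrow> (\<forall>x\<in>U. \<forall>\<^sub>F (x', y) in uniformity. x' = x \<longrightarrow> y \<in> U)"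
    for U :: "circle set"
    by (rule open_circle_def)
  show "dist x y = 0 \<longleftrightarrow> x = y" for x y :: circle
  proof (transfer, unfold INF_int_dist_eq)
    fix x y :: real
    show "\<bar>x - y - of_int (round (x - y))\<bar> = 0 \<longleftrightarrow> x - y \<in> \<int>"
    proof
      assume "\<bar>x - y - of_int (round (x - y))\<bar> = 0"
      then have "x - y = of_int (round (x - y))" by simp
      then show "x - y \<in> \<int>" by (metis Ints_of_int)
    next
      assume "x - y \<in> \<int>"
      then obtain j where "x - y = of_int j" by (auto elim: Ints_cases)
      then show "\<bar>x - y - of_int (round (x - y))\<bar> = 0" by simp
    qed
  qed
  show "dist x y \<le> dist x z + dist y z" for x y z :: circle
  proof (transfer, unfold INF_int_dist_eq)
    fix x y z :: real
    let ?r = "round (x - z)" and ?s = "round (y - z)"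
    show "\<bar>x - y - of_int (round (x - y))\<bar>
      \<le> \<bar>x - z - of_int ?r\<bar> + \<bar>y - z - of_int ?s\<bar>"
      using round_diff_minimal[of "x - y" "?r - ?s"] by simp
  qed
qed

end

lift_definition doubling :: "circle \<Rightarrow> circle" is "\<lambda>x. 2 * x"
proof -
  fix x y :: real
  assume "x - y \<in> \<int>"
  then have "2 * (x - y) \<in> \<int>" by (intro Ints_mult) auto
  then show "2 * x - 2 * y \<in> \<int>" by (simp add: algebra_simps)
qed

(* Only meaningful for bounded f, since Sup of an unbounded set of reals is unspecified.
   Lipschitz functions on the circle are bounded: its diameter is at most 1/2. *)
definition sup_norm :: "('a \<Rightarrow> real) \<Rightarrow> real"
  where "sup_norm f = (SUP x. \<bar>f x\<bar>)"

definition skew_map ::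
    "real \<Rightarrow> (nat \<Rightarrow> circle \<Rightarrow> real) \<Rightarrow> nat \<Rightarrow> circle \<times> real \<Rightarrow> circle \<times> real"
  where "skew_map lam A c = (\<lambda>(x, y). (doubling x, A c x + lam * y))"

definition hutchinson ::
    "real \<Rightarrow> nat \<Rightarrow> (nat \<Rightarrow> circle \<Rightarrow> real) \<Rightarrow> (circle \<times> real) set \<Rightarrow> (circle \<times> real) set"
  where "hutchinson lam m A U = (\<Union>c\<in>{0..<m}. skew_map lam A c ` U)"

end

theory Submission
  imports Defs
begin

text \<open>Write \<open>s\<close> for a common bound of the \<open>\<bar>A c x\<bar>\<close>. On heights, every \<open>skew_map lam A c\<close> is
  dominated by the affine contraction \<open>b \<mapsto> s + lam * b\<close>: it sends the strip of half-width \<open>b\<close>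
  into the strip of half-width \<open>s + lam * b\<close> (\<open>hutchinson_strip\<close>). The fixed point of this
  contraction is \<open>s / (1 - lam)\<close>, and \<open>T0\<close> lies strictly above it. Hence \<open>s + lam * T0 < T0\<close>, which
  gives the first claim. A strip of half-width \<open>M\<close> is carried in \<open>n\<close> steps into the strip of
  half-width \<open>s / (1 - lam) + lam ^ n * M\<close> (\<open>hutchinson_iterate_strip\<close>), which eventually drops
  below \<open>T0\<close>: this is the second claim.
  A compact invariant set lies in some strip, and it equals all its forward images;
  by monotonicity it lies in the image of that strip at the time when the image has entered \<open>U0\<close>.

  The maximum of the sup norms can serve as \<open>s\<close> because the circle has finite
  diameter, so that Lipschitz functions on it are bounded (\<open>lipschitz_circle_le_sup_norm\<close>).\<close>

lemma dist_circle_le_half: "dist x y \<le> 1 / 2" for x y :: circle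
proof (transfer, unfold INF_int_dist_eq)
  fix x y :: real
  show "\<bar>x - y - of_int (round (x - y))\<bar> \<le> 1 / 2"
    using of_int_round_abs_le[of "x - y"] by (simp add: abs_minus_commute)
qed

text \<open>Boundedness is the point here: \<open>sup_norm\<close> is a supremum of reals, which is sure to
  dominate the \<open>\<bar>f x\<bar>\<close> only when they have an upper bound.\<close>

lemma lipschitz_circle_le_sup_norm:
  fixes f :: "circle \<Rightarrow> real"
  assumes "L-lipschitz_on UNIV f"
  shows "\<bar>f x\<bar> \<le> sup_norm f"
proof -
  have "\<bar>f y\<bar> \<le> \<bar>f x\<bar> + L * (1 / 2)" for y
  proof -
    have "dist (f y) (f x) \<le> L * dist y x"
      using assms by (auto simp: lipschitz_on_def)
    also have "\<dots> \<le> L * (1 / 2)"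
      using lipschitz_on_nonneg[OF assms] dist_circle_le_half by (rule mult_left_mono[rotated])
    finally show ?thesis unfolding dist_real_def by arith
  qed
  then have "bdd_above (range (\<lambda>y. \<bar>f y\<bar>))" unfolding bdd_above_def by blast
  then show ?thesis unfolding sup_norm_def by (rule cSUP_upper[rotated]) simp
qed

lemma hutchinson_mono: "mono (hutchinson lam m A)"
  by (auto simp: mono_def hutchinson_def)

lemma mem_strip_iff: "p \<in> UNIV \<times> {-b..b} \<longleftrightarrow> \<bar>snd p\<bar> \<le> b" for p :: "'a \<times> real"
  by (cases p) auto

lemma hutchinson_strip:
  assumes "0 \<le> lam" and bound: "\<And>c x. c < m \<Longrightarrow> \<bar>A c x\<bar> \<le> s"
  shows "hutchinson lam m A (UNIV \<times> {-b..b}) \<subseteq> UNIV \<times> {-(s + lam * b)..s + lam * b}"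
proof -
  have "\<bar>A c x + lam * y\<bar> \<le> s + lam * b" if "c < m" "\<bar>y\<bar> \<le> b" for c x y
  proof -
    have "\<bar>lam * y\<bar> \<le> lam * b"
      using assms(1) that(2) by (simp add: abs_mult mult_left_mono)
    then show ?thesis using bound[OF that(1), of x] by linarith
  qed
  then have "skew_map lam A c p \<in> UNIV \<times> {-(s + lam * b)..s + lam * b}"
    if "c < m" "p \<in> UNIV \<times> {-b..b}" for c p
    using that unfolding mem_strip_iff by (cases p) (simp add: skew_map_def)
  then show ?thesis
    unfolding hutchinson_def by (intro UN_least image_subsetI) (simp only: atLeastLessThan_iff)
qed

text \<open>The half-width \<open>s / (1 - lam) + M\<close> is at least \<open>M\<close>, and its excess over the fixed point of
  \<open>b \<mapsto> s + lam * b\<close> is exactly multiplied by \<open>lam\<close> at each step, which gives a closed form.\<close>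

lemma hutchinson_iterate_strip:
  fixes M :: real
  assumes "0 \<le> lam" "lam < 1" "0 \<le> s" and bound: "\<And>c x. c < m \<Longrightarrow> \<bar>A c x\<bar> \<le> s"
  defines "r \<equiv> \<lambda>n::nat. s / (1 - lam) + lam ^ n * M"
  shows "(hutchinson lam m A ^^ n) (UNIV \<times> {-M..M}) \<subseteq> UNIV \<times> {-r n..r n}"
proof (induction n)
  case 0
  have "0 \<le> s / (1 - lam)" using assms by simp
  then show ?case by (auto simp: r_def)
next
  case (Suc n)
  have "(hutchinson lam m A ^^ Suc n) (UNIV \<times> {-M..M})
      \<subseteq> hutchinson lam m A (UNIV \<times> {-r n..r n})"
    using monoD[OF hutchinson_mono Suc.IH] by simp
  also have "\<dots> \<subseteq> UNIV \<times> {-(s + lam * r n)..s + lam * r n}"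
    using assms(1) bound by (rule hutchinson_strip)
  also have "s + lam * r n = r (Suc n)"
    using assms(2) by (simp add: r_def field_simps)
  finally show ?case .
qed

lemma strip_subset_open_strip:
  fixes b t :: real
  assumes "b < t"
  shows "UNIV \<times> {-b..b} \<subseteq> UNIV \<times> {-t<..<t}"
  using assms by auto

lemma hutchinson_closed_strip_absorbed:
  assumes "0 \<le> lam" and "\<And>c x. c < m \<Longrightarrow> \<bar>A c x\<bar> \<le> s" and "s + lam * t < t"
  shows "hutchinson lam m A (closure (UNIV \<times> {-t<..<t})) \<subseteq> UNIV \<times> {-t<..<t}"
proof -
  have "closure (UNIV \<times> {-t<..<t}) \<subseteq> (UNIV :: circle set) \<times> {-t..t}"
    by (rule closure_minimal) (auto intro: closed_Times)
  then have "hutchinson lam m A (closure (UNIV \<times> {-t<..<t})) \<subseteq> hutchinson lam m A (UNIV \<times> {-t..t})"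
    by (rule monoD[OF hutchinson_mono])
  also have "\<dots> \<subseteq> UNIV \<times> {-(s + lam * t)..s + lam * t}"
    using assms(1,2) by (rule hutchinson_strip)
  also have "\<dots> \<subseteq> UNIV \<times> {-t<..<t}"
    using assms(3) by (rule strip_subset_open_strip)
  finally show ?thesis .
qed

lemma hutchinson_strip_eventually_absorbed:
  assumes "0 \<le> lam" "lam < 1" "0 \<le> s" "\<And>c x. c < m \<Longrightarrow> \<bar>A c x\<bar> \<le> s"
    and "s / (1 - lam) < t"
  obtains n where "(hutchinson lam m A ^^ n) (UNIV \<times> {-M..M}) \<subseteq> UNIV \<times> {-t<..<t}"
proof -
  have "(\<lambda>n. s / (1 - lam) + lam ^ n * M) \<longlonglongrightarrow> s / (1 - lam) + 0 * M"
    using assms(1,2) by (intro tendsto_intros LIMSEQ_power_zero) simp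
  then have "\<forall>\<^sub>F n in sequentially. s / (1 - lam) + lam ^ n * M < t"
    using assms(5) by (intro order_tendstoD(2)) auto
  then obtain n where "s / (1 - lam) + lam ^ n * M < t"
    by (auto simp: eventually_sequentially)
  then have "(hutchinson lam m A ^^ n) (UNIV \<times> {-M..M}) \<subseteq> UNIV \<times> {-t<..<t}"
    using order_trans[OF hutchinson_iterate_strip[OF assms(1-4)] strip_subset_open_strip] by simp
  then show ?thesis by (rule that)
qed

lemma bounded_subset_strip:
  fixes K :: "('a::metric_space \<times> real) set"
  assumes "bounded K"
  obtains M where "K \<subseteq> UNIV \<times> {-M..M}"
proof -
  obtain M where "\<And>y. y \<in> snd ` K \<Longrightarrow> norm y \<le> M"
    using bounded_snd[OF assms] by (auto simp: bounded_pos)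
  then have "K \<subseteq> UNIV \<times> {-M..M}" unfolding subset_iff mem_strip_iff by simp
  then show ?thesis by (rule that)
qed

lemma hutchinson_invariant_subset:
  assumes fixed: "hutchinson lam m A K = K" and "K \<subseteq> V"
  shows "K \<subseteq> (hutchinson lam m A ^^ n) V"
proof -
  have "(hutchinson lam m A ^^ n) K = K" by (induction n) (simp_all add: fixed)
  moreover have "(hutchinson lam m A ^^ n) K \<subseteq> (hutchinson lam m A ^^ n) V"
    using mono_pow[OF hutchinson_mono] \<open>K \<subseteq> V\<close> by (rule monoD)
  ultimately show ?thesis by simp
qed

theorem theorem2p2:
  fixes lam T0 :: real and m :: nat and A :: "nat \<Rightarrow> circle \<Rightarrow> real"
    and U0 :: "(circle \<times> real) set"
  assumes "0 < lam" "lam < 1"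
    and "m \<ge> 2"
    and "\<And>c. c \<in> {0..<m} \<Longrightarrow> \<exists>L. L-lipschitz_on UNIV (A c)"
    and "T0 > 1 / (1 - lam) * (MAX c\<in>{0..<m}. sup_norm (A c))"
    and "U0 = UNIV \<times> {-T0<..<T0}"
  shows "hutchinson lam m A (closure U0) \<subseteq> U0
    \<and> (\<forall>M>0. \<exists>n. (hutchinson lam m A ^^ n) (UNIV \<times> {-M..M}) \<subseteq> U0)
    \<and> (\<forall>K. K \<noteq> {} \<and> compact K \<and> hutchinson lam m A K = K \<longrightarrow> K \<subseteq> U0)"
proof -
  define s where "s = (MAX c\<in>{0..<m}. sup_norm (A c))"
  have bound: "\<bar>A c x\<bar> \<le> s" if "c < m" for c x
  proof -
    have "\<bar>A c x\<bar> \<le> sup_norm (A c)"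
      using assms(4)[of c] that lipschitz_circle_le_sup_norm by auto
    also have "\<dots> \<le> s" unfolding s_def using that by (intro Max_ge) auto
    finally show ?thesis .
  qed
  have "0 \<le> s" using bound[of 0 "circle_of 0"] assms(3) by simp
  have above: "s / (1 - lam) < T0" using assms(5) by (simp add: s_def)
  then have "s + lam * T0 < T0" using assms(2) by (simp add: field_simps)
  then have absorbing: "hutchinson lam m A (closure U0) \<subseteq> U0"
    unfolding assms(6) using assms(1) bound by (intro hutchinson_closed_strip_absorbed) auto
  have attracting: "\<exists>n. (hutchinson lam m A ^^ n) (UNIV \<times> {-M..M}) \<subseteq> U0" for M
    unfolding assms(6)
    by (rule hutchinson_strip_eventually_absorbed
        [OF less_imp_le[OF assms(1)] assms(2) \<open>0 \<le> s\<close> bound above]) (assumption, rule exI)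
  have "K \<subseteq> U0" if comp: "compact K" and fixed: "hutchinson lam m A K = K" for K
  proof -
    obtain M where "K \<subseteq> UNIV \<times> {-M..M}"
      by (rule bounded_subset_strip[OF compact_imp_bounded[OF comp]])
    then have "K \<subseteq> (hutchinson lam m A ^^ n) (UNIV \<times> {-M..M})" for n
      by (rule hutchinson_invariant_subset[OF fixed])
    moreover obtain n where "(hutchinson lam m A ^^ n) (UNIV \<times> {-M..M}) \<subseteq> U0"
      using attracting by (rule exE)
    ultimately show ?thesis by (rule order_trans)
  qed
  then show ?thesis using absorbing attracting by simp
qed

end
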